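(* Let $\eta_n>0$, $n\ge 1$ and $0<\delta<1$. Let $a_{n,S}^*$, $a_{n,H}^*$, $a_{n,A}^*$ be the half-lengths of the shortest intervals with infimal coverage probability equal to $\delta$ based on the soft-thresholding (LASSO), hard-thresholding, and adaptive LASSO estimators, respectively. Then $$a_{n,H}^*>a_{n,A}^*>a_{n,S}^*>n^{-1/2}\Phi^{-1}((1+\delta)/2),$$ where $n^{-1/2}\Phi^{-1}((1+\delta)/2)$ is the half-length of the standard confidence interval with coverage probability $\delta$ based on the maximum likelihood estimator $\bar y$.
   Context: The data $y_1,\dots,y_n$ are i.i.d. $N(\theta,1)$ with $\theta\in\mathbb{R}$ unknown (variance known and equal to $1$); $P_{n,\theta}$ is the distribution of the sample under $\theta$, and $\bar y=n^{-1}\sum_{i=1}^n y_i$. The tuning parameter $\eta_n$ is a positive real number. Estimators: soft-thresholding (LASSO) $\hat\theta_S=\operatorname{sign}(\bar y)(|\bar y|-\eta_n)_+$ with $z_+=\max\{z,0\}$ and $\operatorname{sign}(0)=0$; hard-thresholding $\hat\theta_H=\bar y\,\mathbf{1}(|\bar y|>\eta_n)$; adaptive LASSO $\hat\theta_A=0$ if $|\bar y|\le\eta_n$ and $\hat\theta_A=\bar y-\eta_n^2/\bar y$ if $|\bar y|>\eta_n$. The infimal coverage probability of $[\hat\theta-a_n,\hat\theta+b_n]$ ($a_n,b_n\geq0$) is $\inf_{\theta\in\mathbb{R}}P_{n,\theta}(\theta\in[\hat\theta-a_n,\hat\theta+b_n])$. For each of the three estimators the shortest interval of this form with infimal coverage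 probability not less than $\delta$ exists, is unique, is symmetric ($a_n=b_n$), and has infimal coverage probability exactly $\delta$; its half-length is the unique solution $a\ge 0$ of: $\Phi(n^{1/2}(a-\eta_n))-\Phi(n^{1/2}(-a-\eta_n))=\delta$ for $a=a_{n,S}^*$; $\Phi(n^{1/2}(a-\eta_n))-\Phi(-n^{1/2}a)=\delta$ for $a=a_{n,H}^*$; $\Phi(n^{1/2}(a-\eta_n))-\Phi(-n^{1/2}\sqrt{a^2+\eta_n^2})=\delta$ for $a=a_{n,A}^*$. $\Phi$ is the standard normal cumulative distribution function. *)

theory Defs
  imports "HOL-Probability.Probability"
begin

definition sample_dist :: "nat \<Rightarrow> real \<Rightarrow> (nat \<Rightarrow> real) measure" where
  "sample_dist n \<theta> = (\<Pi>\<^sub>M i\<in>{1..n}. density lborel (normal_density \<theta> 1))"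

definition sample_mean :: "nat \<Rightarrow> (nat \<Rightarrow> real) \<Rightarrow> real" where
  "sample_mean n y = (\<Sum>i=1..n. y i) / real n"

definition soft_thresholding :: "nat \<Rightarrow> real \<Rightarrow> (nat \<Rightarrow> real) \<Rightarrow> real" where
  "soft_thresholding n \<eta> y = sgn (sample_mean n y) * max (\<bar>sample_mean n y\<bar> - \<eta>) 0"

definition hard_thresholding :: "nat \<Rightarrow> real \<Rightarrow> (nat \<Rightarrow> real) \<Rightarrow> real" where
  "hard_thresholding n \<eta> y = (if \<bar>sample_mean n y\<bar> > \<eta> then sample_mean n y else 0)"

definition adaptive_lasso :: "nat \<Rightarrow> real \<Rightarrow> (nat \<Rightarrow> real) \<Rightarrow> real" where
  "adaptive_lasso n \<eta> y =
     (if \<bar>sample_mean n y\<bar> \<le> \<eta> then 0 else sample_mean n y - \<eta>\<^sup>2 / sample_mean n y)"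

definition coverage :: "nat \<Rightarrow> ((nat \<Rightarrow> real) \<Rightarrow> real) \<Rightarrow> real \<Rightarrow> real \<Rightarrow> real \<Rightarrow> real" where
  "coverage n est a b \<theta> =
     measure (sample_dist n \<theta>) {y \<in> space (sample_dist n \<theta>). \<theta> \<in> {est y - a .. est y + b}}"

definition infimal_coverage :: "nat \<Rightarrow> ((nat \<Rightarrow> real) \<Rightarrow> real) \<Rightarrow> real \<Rightarrow> real \<Rightarrow> real" where
  "infimal_coverage n est a b = (INF \<theta>. coverage n est a b \<theta>)"

(* The interval [est - a, est + b] has infimal coverage probability delta and is shortest among
   all intervals of this form, symmetric or not, whose infimal coverage is not less than delta. *)
definition shortest_interval ::
    "nat \<Rightarrow> ((nat \<Rightarrow> real) \<Rightarrow> real) \<Rightarrow> real \<Rightarrow> real \<Rightarrow> real \<Rightarrow> bool" where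
  "shortest_interval n est \<delta> a b \<longleftrightarrow>
     a \<ge> 0 \<and> b \<ge> 0 \<and> infimal_coverage n est a b = \<delta> \<and>
     (\<forall>a' b'. a' \<ge> 0 \<longrightarrow> b' \<ge> 0 \<longrightarrow> infimal_coverage n est a' b' \<ge> \<delta> \<longrightarrow> a + b \<le> a' + b')"

(* All shortest intervals have the same length, so the description is proper as soon as
   one exists. *)
definition shortest_half_length :: "nat \<Rightarrow> ((nat \<Rightarrow> real) \<Rightarrow> real) \<Rightarrow> real \<Rightarrow> real" where
  "shortest_half_length n est \<delta> = (THE h. \<exists>a b. shortest_interval n est \<delta> a b \<and> h = (a + b) / 2)"

definition std_normal_cdf :: "real \<Rightarrow> real" where
  "std_normal_cdf = cdf std_normal_distribution"

(* The range of the cdf is the open unit interval; only there is this the inverse function. *)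
definition std_normal_quantile :: "real \<Rightarrow> real" where
  "std_normal_quantile = inv std_normal_cdf"

definition standard_half_length :: "nat \<Rightarrow> real \<Rightarrow> real" where
  "standard_half_length n \<delta> = real n powr (- 1 / 2) * std_normal_quantile ((1 + \<delta>) / 2)"

end

theory Submission
  imports Defs
begin

text \<open>
  Write the error of the sample mean as \<open>w = ybar - \<theta>\<close>, a centred normal variable with distribution
  function \<open>G\<close>. For an odd thresholding rule \<open>T\<close> the coverage at \<open>\<theta>\<close> is the probability that
  \<open>\<theta> \<in> [T (\<theta> + w) - a, T (\<theta> + w) + b]\<close>. As soon as \<open>\<theta>\<close> exceeds \<open>b\<close>, an estimate equal to \<open>0\<close> no
  longer covers \<open>\<theta>\<close>; so the coverage drops there, and this drop is what makes thresholding
  expensive. For \<open>b \<le> a\<close> the limit of the coverage as \<open>\<theta>\<close> decreases to \<open>b\<close> is the mass of an interval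
  from \<open>\<eta> - b\<close> to \<open>u m + (a - b) / 2\<close>, where \<open>m = (a + b) / 2\<close> and where \<open>u m\<close> is \<open>m + \<eta>\<close> for soft
  thresholding, \<open>sqrt (m\<^sup>2 + \<eta>\<^sup>2)\<close> for the adaptive LASSO and \<open>m\<close> for hard thresholding.
  
  This interval is \<open>[\<eta> - m, u m]\<close> shifted to the right by \<open>(a - b) / 2\<close>, and \<open>[\<eta> - m, u m]\<close> has
  its centre to the right of \<open>0\<close> already. The normal density being symmetric and unimodal, the shift
  loses mass. Hence every interval of length \<open>2 * m\<close> has infimal coverage at most
  \<open>G (u m) - G (\<eta> - m)\<close> (the case \<open>a < b\<close> follows by reflection), and the symmetric one attains this
  bound: for \<open>\<bar>\<theta>\<bar> \<le> a\<close> all errors in \<open>[- a, a]\<close> are covered, and beyond \<open>a\<close> the interval of covered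
  errors is at least as long and at least as central as in the limit at \<open>a\<close>. So the shortest
  half-length is the root \<open>h > 0\<close> of \<open>G (u h) - G (\<eta> - h) = \<delta>\<close>
  (\<open>shortest_half_length_threshold\<close>).
  
  A larger \<open>u\<close> means a smaller root, and \<open>m < sqrt (m\<^sup>2 + \<eta>\<^sup>2) < m + \<eta>\<close>; this orders the three
  estimators (\<open>shortest_half_length_less\<close>). Even for the largest \<open>u\<close>, the mass of
  \<open>[- m + \<eta>, m + \<eta>]\<close> is less than that of \<open>[- m, m]\<close>, which puts the standard interval below
  all of them (\<open>standard_half_length_less_threshold\<close>).
\<close>

section \<open>Intervals under a symmetric unimodal distribution\<close>

locale symmetric_unimodal = real_distribution M for M +
  fixes g :: "real \<Rightarrow> real"
  assumes DERIV_cdf: "(cdf M has_real_derivative g x) (at x)"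
    and density_pos: "0 < g x"
    and density_even: "g (- x) = g x"
    and density_less: "\<bar>x\<bar> < \<bar>y\<bar> \<Longrightarrow> g y < g x"
begin

abbreviation G :: "real \<Rightarrow> real" where "G \<equiv> cdf M"

lemma density_le: "\<bar>x\<bar> \<le> \<bar>y\<bar> \<Longrightarrow> g y \<le> g x"
proof (cases "\<bar>x\<bar> = \<bar>y\<bar>")
  case True
  then have "y = x \<or> y = - x" by linarith
  then show ?thesis using density_even by auto
qed (use density_less[of x y] in auto)

lemma isCont_G: "isCont G x"
  using DERIV_cdf by (rule DERIV_isCont)

lemma continuous_on_G: "continuous_on A G"
  by (simp add: continuous_at_imp_continuous_on isCont_G)

lemma G_strict_mono: "x < y \<Longrightarrow> G x < G y"
  using DERIV_cdf density_pos by (metis DERIV_pos_imp_increasing)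

lemma G_less_iff: "G x < G y \<longleftrightarrow> x < y"
  using G_strict_mono by (metis linorder_less_linear order_less_asym)

lemma G_le_iff: "G x \<le> G y \<longleftrightarrow> x \<le> y"
  using G_less_iff by (meson not_less)

text \<open>
  The sum \<open>G x + G (- x)\<close> has derivative \<open>0\<close>, and its limit at infinity is \<open>1\<close>.
\<close>

lemma G_minus: "G (- x) = 1 - G x"
proof -
  have "((\<lambda>x. G x + G (- x)) has_real_derivative g x + g (- x) * (- 1)) (at x)" for x
    by (intro DERIV_add DERIV_cdf DERIV_chain2[of G] DERIV_minus[OF DERIV_ident])
  then have "((\<lambda>x. G x + G (- x)) has_real_derivative 0) (at x)" for x
    by (simp add: density_even)
  then have const: "G y + G (- y) = G x + G (- x)" for y
    using DERIV_isconst_all[of "\<lambda>x. G x + G (- x)" y x] by blast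
  have "((\<lambda>y. G y + G (- y)) \<longlongrightarrow> 1 + 0) at_top"
    by (intro tendsto_add cdf_lim_at_top_prob
        filterlim_compose[OF cdf_lim_at_bot filterlim_uminus_at_bot_at_top])
  moreover have "(\<lambda>y. G y + G (- y)) = (\<lambda>y. G x + G (- x))"
    using const by blast
  ultimately have "((\<lambda>y. G x + G (- x)) \<longlongrightarrow> 1) (at_top :: real filter)" by simp
  then have "G x + G (- x) = 1"
    using tendsto_const_iff[OF trivial_limit_at_top_linorder] by blast
  then show ?thesis by simp
qed

lemma measure_singleton: "measure M {x} = 0"
  using isCont_G isCont_cdf by blast

lemma measure_Ioc: "measure M {l<..u} = max 0 (G u - G l)"
proof (cases "l < u")
  case True
  then show ?thesis using cdf_diff_eq[OF True] measure_nonneg[of M "{l<..u}"] by simp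
next
  case False
  then show ?thesis using G_le_iff[of u l] by simp
qed

lemma measure_Icc: "measure M {l..u} = max 0 (G u - G l)"
proof (cases "l \<le> u")
  case True
  then have "{l..u} = {l} \<union> {l<..u}" by auto
  moreover have "measure M ({l} \<union> {l<..u}) = measure M {l} + measure M {l<..u}"
    by (rule finite_measure_Union) auto
  ultimately show ?thesis by (simp add: measure_singleton measure_Ioc)
next
  case False
  then show ?thesis using G_le_iff[of u l] by simp
qed

text \<open>
  Only the density is assumed even. The reflected measure has distribution function
  \<open>x \<mapsto> 1 - G (- x)\<close> because points carry no mass, and this is \<open>G\<close>.
\<close>

lemma distr_uminus: "distr M borel uminus = M"
proof (rule cdf_unique)
  show "real_distribution (distr M borel uminus)" by (intro real_distribution_distr) auto
  show "real_distribution M" by unfold_locales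
  show "cdf (distr M borel uminus) = cdf M"
  proof
    fix x
    have "cdf (distr M borel uminus) x = measure M {- x..}"
      unfolding cdf_def by (subst measure_distr) (auto intro!: arg_cong[where f = "measure M"])
    also have "{- x..} = {- x} \<union> (UNIV - {..- x})" by auto
    also have "measure M \<dots> = measure M {- x} + measure M (UNIV - {..- x})"
      by (rule finite_measure_Union) auto
    also have "\<dots> = 1 - G (- x)"
      using prob_compl[of "{..- x}"] by (simp add: measure_singleton cdf_def)
    finally show "cdf (distr M borel uminus) x = cdf M x" using G_minus[of x] by simp
  qed
qed

lemma measure_reflect:
  assumes "A \<in> sets borel"
  shows "measure M (uminus -` A) = measure M A"
proof -
  have "measure M A = measure (distr M borel uminus) A" by (simp add: distr_uminus)
  also have "\<dots> = measure M (uminus -` A)" using assms by (subst measure_distr) auto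
  finally show ?thesis by simp
qed

lemma DERIV_shifted_mass:
  "((\<lambda>t. G (u + t) - G (l + t)) has_real_derivative g (u + t) - g (l + t)) (at t)"
proof -
  have "((\<lambda>t. G (x + t)) has_real_derivative g (x + t) * 1) (at t)" for x
    by (rule DERIV_chain2[OF DERIV_cdf]) (auto intro!: derivative_eq_intros)
  then show ?thesis by (auto intro!: DERIV_diff)
qed

text \<open>
  Moving the interval to the right by \<open>dt\<close> gains \<open>g\<close> at the right end and loses \<open>g\<close> at the left
  end. A centre right of \<open>0\<close> means that the right end is the one farther from \<open>0\<close>, where the density
  is smaller.
\<close>

lemma shift_outwards_le:
  assumes "l \<le> u" "0 \<le> l + u" "0 \<le> d"
  shows "G (u + d) - G (l + d) \<le> G u - G l"
proof -
  have "G (u + d) - G (l + d) \<le> G (u + 0) - G (l + 0)"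
  proof (rule DERIV_nonpos_imp_nonincreasing[OF \<open>0 \<le> d\<close>])
    fix t assume "0 \<le> t" "t \<le> d"
    then have "g (u + t) \<le> g (l + t)" by (intro density_le) (use assms in linarith)
    then show "\<exists>y. ((\<lambda>t. G (u + t) - G (l + t)) has_real_derivative y) (at t) \<and> y \<le> 0"
      using DERIV_shifted_mass by (meson diff_le_0_iff_le)
  qed
  then show ?thesis by simp
qed

lemma shift_outwards_less:
  assumes "l < u" "0 \<le> l + u" "0 < d"
  shows "G (u + d) - G (l + d) < G u - G l"
proof -
  have "G (u + d) - G (l + d) < G (u + 0) - G (l + 0)"
  proof (rule DERIV_neg_imp_decreasing_open[OF \<open>0 < d\<close>])
    fix t assume "0 < t" "t < d"
    then have "g (u + t) < g (l + t)" by (intro density_less) (use assms in linarith)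
    then show "\<exists>y. ((\<lambda>t. G (u + t) - G (l + t)) has_real_derivative y) (at t) \<and> y < 0"
      using DERIV_shifted_mass by (meson diff_less_0_iff_less)
  next
    show "continuous_on {0..d} (\<lambda>t. G (u + t) - G (l + t))"
      using DERIV_isCont[OF DERIV_shifted_mass] by (blast intro: continuous_at_imp_continuous_on)
  qed
  then show ?thesis by simp
qed

text \<open>
  Shift \<open>[l, u]\<close> to the left until its right end is \<open>U\<close>. Its left end is then still to the right of
  \<open>L\<close>, so the shifted interval is contained in \<open>[L, U]\<close> and its centre is nonnegative: the
  shift has not lost mass.
\<close>

lemma longer_and_more_central_le:
  assumes "L \<le> l" "U \<le> u" "u - l \<le> U - L" "0 \<le> L + U" "l \<le> u"
  shows "G u - G l \<le> G U - G L"
proof -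
  have "G (U + (u - U)) - G (l - (u - U) + (u - U)) \<le> G U - G (l - (u - U))"
    by (rule shift_outwards_le) (use assms in linarith)+
  moreover have "G L \<le> G (l - (u - U))" using assms by (simp add: G_le_iff)
  ultimately show ?thesis by simp
qed

lemma symmetric_mass: "G m - G (- m) = 2 * G m - 1"
  by (simp add: G_minus)

end

section \<open>Thresholding rules\<close>

definition covering_errors :: "(real \<Rightarrow> real) \<Rightarrow> real \<Rightarrow> real \<Rightarrow> real \<Rightarrow> real set" where
  "covering_errors T a b \<theta> = {w. \<theta> \<in> {T (\<theta> + w) - a..T (\<theta> + w) + b}}"

text \<open>
  What the three rules have in common. The function \<open>u\<close> is the right end of the set of errors covered
  by the symmetric interval of half-length \<open>m\<close>, in the limit as \<open>\<theta>\<close> decreases to \<open>m\<close>; the left end is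
  always \<open>\<eta> - m\<close>, since the sample mean must exceed \<open>\<eta>\<close> for the estimate to be positive. The
  assumption \<open>errors_outer\<close> bounds the coverage near the jump from above for all intervals with
  \<open>b \<le> a\<close>, and \<open>errors_inner\<close> bounds it from below beyond the jump for symmetric ones.
\<close>

locale threshold_rule =
  fixes T u :: "real \<Rightarrow> real" and \<eta> :: real
  assumes threshold_pos: "0 < \<eta>"
    and rule_measurable [measurable]: "T \<in> borel_measurable borel"
    and rule_odd: "T (- y) = - T y"
    and rule_shrinks: "0 \<le> y \<Longrightarrow> 0 \<le> T y \<and> T y \<le> y"
    and reach_bounds: "0 \<le> m \<Longrightarrow> m \<le> u m \<and> u m \<le> m + \<eta>"
    and reach_mono: "0 \<le> m \<Longrightarrow> m \<le> m' \<Longrightarrow> u m \<le> u m'"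
    and reach_continuous: "continuous_on UNIV u"
    and errors_outer: "0 \<le> b \<Longrightarrow> b \<le> a \<Longrightarrow> \<exists>L U.
        (\<forall>\<theta>>b. covering_errors T a b \<theta> \<subseteq> {L \<theta>..U \<theta>}) \<and>
        (L \<longlongrightarrow> \<eta> - b) (at_right b) \<and> (U \<longlongrightarrow> u ((a + b) / 2) + (a - b) / 2) (at_right b)"
    and errors_inner: "0 \<le> a \<Longrightarrow> a < \<theta> \<Longrightarrow> \<exists>L U.
        {L..U} \<subseteq> covering_errors T a a \<theta> \<and>
        L \<le> \<eta> - a \<and> U \<le> u a \<and> u a - (\<eta> - a) \<le> U - L \<and> 0 \<le> L + U"
begin

lemma covering_errors_measurable: "covering_errors T a b \<theta> \<in> sets borel"
  unfolding covering_errors_def atLeastAtMost_iff by measurable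

lemma covering_errors_minus:
  "covering_errors T a b (- \<theta>) = uminus -` covering_errors T b a \<theta>"
proof -
  have "T (- \<theta> + w) = - T (\<theta> + - w)" for w
    using rule_odd[of "\<theta> + - w"] by simp
  then show ?thesis by (auto simp: covering_errors_def)
qed

text \<open>
  The estimate lies between \<open>0\<close> and the sample mean \<open>\<theta> + w\<close>, and both of these are within \<open>a\<close>
  of \<open>\<theta>\<close>.
\<close>

lemma covering_errors_near_0:
  assumes "0 \<le> \<theta>" "\<theta> \<le> a"
  shows "{- a..a} \<subseteq> covering_errors T a a \<theta>"
proof
  fix w assume "w \<in> {- a..a}"
  then show "w \<in> covering_errors T a a \<theta>"
    using rule_shrinks[of "\<theta> + w"] rule_shrinks[of "- (\<theta> + w)"] rule_odd[of "\<theta> + w"] assms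
    by (cases "0 \<le> \<theta> + w") (auto simp: covering_errors_def)
qed

end

locale threshold_problem = symmetric_unimodal M g + threshold_rule T u \<eta>
  for M g T u \<eta>
begin

definition cover :: "real \<Rightarrow> real \<Rightarrow> real \<Rightarrow> real" where
  "cover a b \<theta> = measure M (covering_errors T a b \<theta>)"

text \<open>
  The limit of the coverage of the symmetric interval of half-length \<open>m\<close> as \<open>\<theta>\<close> decreases to \<open>m\<close>,
  provided that \<open>\<eta> - m \<le> u m\<close>. For smaller \<open>m\<close> the coverage tends to \<open>0\<close> and this value is negative;
  allowing that keeps the function strictly increasing.
\<close>

definition jump_coverage :: "real \<Rightarrow> real" where
  "jump_coverage m = G (u m) - G (\<eta> - m)"

lemma cover_minus: "cover a b (- \<theta>) = cover b a \<theta>"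
  unfolding cover_def covering_errors_minus
  by (rule measure_reflect[OF covering_errors_measurable])

lemma INF_cover_commute: "(INF \<theta>. cover a b \<theta>) = (INF \<theta>. cover b a \<theta>)"
proof -
  have "range (cover a b) = range (\<lambda>\<theta>. cover a b (- \<theta>))"
    by (metis (no_types) minus_minus rangeI image_subset_iff subset_antisym)
  then show ?thesis by (simp add: cover_minus)
qed

lemma INF_cover_le: "(INF \<theta>. cover a b \<theta>) \<le> cover a b \<theta>"
proof (rule cINF_lower)
  show "bdd_below (range (cover a b))"
    by (rule bdd_belowI[of _ 0]) (auto simp: cover_def)
qed simp

text \<open>
  The infimum is below the coverage at every \<open>\<theta> > b\<close>, hence below the limit at \<open>b\<close> from the right.
\<close>

lemma INF_cover_le_limit:
  assumes "0 \<le> b" "b \<le> a"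
  shows "(INF \<theta>. cover a b \<theta>)
           \<le> max 0 (G (u ((a + b) / 2) + (a - b) / 2) - G (\<eta> - b))"
proof -
  obtain L U where sub: "\<And>\<theta>. \<theta> > b \<Longrightarrow> covering_errors T a b \<theta> \<subseteq> {L \<theta>..U \<theta>}"
    and L: "(L \<longlongrightarrow> \<eta> - b) (at_right b)"
    and U: "(U \<longlongrightarrow> u ((a + b) / 2) + (a - b) / 2) (at_right b)"
    using errors_outer[OF assms] by blast
  have lim: "((\<lambda>\<theta>. max 0 (G (U \<theta>) - G (L \<theta>)))
      \<longlongrightarrow> max 0 (G (u ((a + b) / 2) + (a - b) / 2) - G (\<eta> - b))) (at_right b)"
    by (intro tendsto_max tendsto_diff tendsto_const isCont_tendsto_compose[OF isCont_G] L U)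
  show ?thesis
  proof (rule tendsto_lowerbound[OF lim])
    show "\<forall>\<^sub>F \<theta> in at_right b. (INF \<theta>. cover a b \<theta>) \<le> max 0 (G (U \<theta>) - G (L \<theta>))"
      unfolding eventually_at_filter
    proof (intro always_eventually allI impI)
      fix \<theta> assume "\<theta> \<in> {b<..}"
      then have "cover a b \<theta> \<le> measure M {L \<theta>..U \<theta>}"
        unfolding cover_def by (intro finite_measure_mono sub) auto
      then show "(INF \<theta>. cover a b \<theta>) \<le> max 0 (G (U \<theta>) - G (L \<theta>))"
        using INF_cover_le[of a b \<theta>] by (simp add: measure_Icc)
    qed
  qed simp
qed

text \<open>
  The optimality of symmetric intervals. The case \<open>a < b\<close> reduces to \<open>b \<le> a\<close> by reflection. With
  \<open>m = (a + b) / 2\<close> and \<open>d = (a - b) / 2 \<ge> 0\<close>, the limiting interval is \<open>[\<eta> - m, u m]\<close> shifted by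
  \<open>d\<close> away from \<open>0\<close>. The assumption \<open>0 < \<delta>\<close> excludes that it is empty.
\<close>

lemma INF_cover_le_jump_coverage:
  assumes "0 \<le> a" "0 \<le> b" "0 < \<delta>" "\<delta> \<le> (INF \<theta>. cover a b \<theta>)"
  shows "\<delta> \<le> jump_coverage ((a + b) / 2)"
proof -
  have wlog: "\<delta> \<le> jump_coverage ((a + b) / 2)"
    if "0 \<le> b" "b \<le> a" and inf: "\<delta> \<le> (INF \<theta>. cover a b \<theta>)" for a b
  proof -
    define m d where "m = (a + b) / 2" and "d = (a - b) / 2"
    have m: "0 \<le> m" "0 \<le> d" "\<eta> - b = \<eta> - m + d"
      using that by (auto simp: m_def d_def field_simps)
    have *: "\<delta> \<le> G (u m + d) - G (\<eta> - m + d)"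
      using INF_cover_le_limit[OF that(1,2)] inf \<open>0 < \<delta>\<close>
      unfolding m_def[symmetric] d_def[symmetric] m(3) by linarith
    then have "\<eta> - m + d \<le> u m + d"
      using \<open>0 < \<delta>\<close> G_less_iff[of "\<eta> - m + d" "u m + d"] by linarith
    then have "G (u m + d) - G (\<eta> - m + d) \<le> G (u m) - G (\<eta> - m)"
      using m reach_bounds[of m] threshold_pos by (intro shift_outwards_le) auto
    with * show ?thesis by (simp add: jump_coverage_def m_def)
  qed
  show ?thesis
  proof (cases "b \<le> a")
    case True
    then show ?thesis using wlog assms by blast
  next
    case False
    then have "\<delta> \<le> jump_coverage ((b + a) / 2)"
      using wlog[of a b] assms INF_cover_commute[of a b] by simp
    then show ?thesis by (simp add: add.commute)
  qed
qed

text \<open>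
  Since \<open>u m \<le> m + \<eta>\<close>, it suffices to consider \<open>[- m + \<eta>, m + \<eta>]\<close>, which is a proper shift
  of \<open>[- m, m]\<close>.
\<close>

lemma jump_coverage_less_symmetric_mass:
  assumes "0 < m"
  shows "jump_coverage m < G m - G (- m)"
proof -
  have "G (m + \<eta>) - G (- m + \<eta>) < G m - G (- m)"
    by (rule shift_outwards_less) (use assms threshold_pos in auto)
  moreover have "G (u m) \<le> G (m + \<eta>)" using reach_bounds[of m] assms by (simp add: G_le_iff)
  ultimately show ?thesis by (simp add: jump_coverage_def add.commute)
qed

text \<open>
  The worst case for a symmetric interval is the limit at its own half-length. Up to \<open>a\<close> the coverage
  is at least the mass of \<open>[- a, a]\<close>; beyond \<open>a\<close> the covered errors contain an interval that is at least
  as long as the limiting one and no farther from the centre.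
\<close>

lemma jump_coverage_le_cover:
  assumes "0 < a" "\<eta> - a \<le> u a"
  shows "jump_coverage a \<le> cover a a \<theta>"
proof -
  have nonneg: "jump_coverage a \<le> cover a a \<theta>" if "0 \<le> \<theta>" for \<theta>
  proof (cases "\<theta> \<le> a")
    case True
    have "jump_coverage a \<le> measure M {- a..a}"
      using jump_coverage_less_symmetric_mass[OF \<open>0 < a\<close>] by (simp add: measure_Icc)
    also have "\<dots> \<le> cover a a \<theta>"
      unfolding cover_def using covering_errors_measurable
      by (intro finite_measure_mono covering_errors_near_0 that True) auto
    finally show ?thesis .
  next
    case False
    then obtain L U where sub: "{L..U} \<subseteq> covering_errors T a a \<theta>"
      and LU: "L \<le> \<eta> - a" "U \<le> u a" "u a - (\<eta> - a) \<le> U - L" "0 \<le> L + U"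
      using errors_inner[of a \<theta>] assms by auto
    have "jump_coverage a \<le> G U - G L"
      unfolding jump_coverage_def by (rule longer_and_more_central_le[OF LU assms(2)])
    also have "\<dots> \<le> measure M {L..U}" by (simp add: measure_Icc)
    also have "\<dots> \<le> cover a a \<theta>"
      unfolding cover_def using covering_errors_measurable
      by (intro finite_measure_mono sub) auto
    finally show ?thesis .
  qed
  show ?thesis
  proof (cases "0 \<le> \<theta>")
    case False
    then show ?thesis using nonneg[of "- \<theta>"] cover_minus[of a a \<theta>] by simp
  qed (rule nonneg)
qed

lemma jump_coverage_less:
  assumes "0 \<le> m" "m < m'"
  shows "jump_coverage m < jump_coverage m'"
proof -
  have "G (u m) \<le> G (u m')" using reach_mono[of m m'] assms by (simp add: G_le_iff)
  moreover have "G (\<eta> - m') < G (\<eta> - m)" using assms by (simp add: G_less_iff)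
  ultimately show ?thesis by (simp add: jump_coverage_def)
qed

lemma jump_coverage_less_iff: "0 \<le> m \<Longrightarrow> 0 \<le> m' \<Longrightarrow> jump_coverage m < jump_coverage m' \<longleftrightarrow> m < m'"
  using jump_coverage_less by (metis linorder_less_linear order_less_asym)

text \<open>
  The value at \<open>0\<close> is not positive because \<open>u 0 \<le> \<eta>\<close>, and \<open>u m \<ge> m\<close> makes the limit at
  infinity \<open>1\<close>.
\<close>

lemma jump_coverage_attains:
  assumes "0 < \<delta>" "\<delta> < 1"
  obtains h where "0 < h" "jump_coverage h = \<delta>"
proof -
  have at_0: "jump_coverage 0 \<le> 0"
    using reach_bounds[of 0] by (simp add: jump_coverage_def G_le_iff)
  have "((\<lambda>m. G m - G (\<eta> - m)) \<longlongrightarrow> 1 - 0) at_top"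
  proof (intro tendsto_diff cdf_lim_at_top_prob filterlim_compose[OF cdf_lim_at_bot])
    show "filterlim (\<lambda>m. \<eta> - m) at_bot at_top"
      unfolding filterlim_at_bot
    proof
      fix Z show "\<forall>\<^sub>F m in at_top. \<eta> - m \<le> Z"
        using eventually_ge_at_top[of "\<eta> - Z"] by eventually_elim linarith
    qed
  qed
  then have "\<forall>\<^sub>F m in at_top. \<delta> < G m - G (\<eta> - m)"
    using assms by (intro order_tendstoD) auto
  then have "\<forall>\<^sub>F m in at_top. 0 \<le> m \<and> \<delta> < G m - G (\<eta> - m)"
    by (intro eventually_conj eventually_ge_at_top)
  then obtain m where m: "0 \<le> m" "\<delta> < G m - G (\<eta> - m)"
    using eventually_happens' trivial_limit_at_top_linorder by blast
  then have "\<delta> \<le> jump_coverage m"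
    using reach_bounds[of m] G_le_iff[of m "u m"] by (simp add: jump_coverage_def)
  moreover have "continuous_on {0..m} jump_coverage"
    unfolding jump_coverage_def
    by (intro continuous_intros continuous_on_compose2[OF continuous_on_G[of UNIV]]
        continuous_on_subset[OF reach_continuous]) auto
  ultimately obtain h where "0 \<le> h" "jump_coverage h = \<delta>"
    using IVT'[of jump_coverage 0 \<delta> m] at_0 assms m by auto
  moreover have "h \<noteq> 0" using at_0 assms \<open>jump_coverage h = \<delta>\<close> by auto
  ultimately show ?thesis using that[of h] by simp
qed

lemma INF_cover_eq:
  assumes "0 < h" "jump_coverage h = \<delta>" "0 < \<delta>"
  shows "(INF \<theta>. cover h h \<theta>) = \<delta>"
proof (rule antisym)
  have "\<eta> - h \<le> u h" using assms G_less_iff[of "\<eta> - h" "u h"] by (simp add: jump_coverage_def)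
  then show ge: "\<delta> \<le> (INF \<theta>. cover h h \<theta>)"
    using jump_coverage_le_cover assms by (intro cINF_greatest) auto
  show "(INF \<theta>. cover h h \<theta>) \<le> \<delta>"
    using INF_cover_le_jump_coverage[of h h "INF \<theta>. cover h h \<theta>"] ge assms by simp
qed

end


section \<open>Soft thresholding, hard thresholding and the adaptive LASSO\<close>

definition soft_rule :: "real \<Rightarrow> real \<Rightarrow> real" where
  "soft_rule \<eta> y = sgn y * max (\<bar>y\<bar> - \<eta>) 0"

definition hard_rule :: "real \<Rightarrow> real \<Rightarrow> real" where
  "hard_rule \<eta> y = (if \<bar>y\<bar> > \<eta> then y else 0)"

definition adaptive_rule :: "real \<Rightarrow> real \<Rightarrow> real" where
  "adaptive_rule \<eta> y = (if \<bar>y\<bar> \<le> \<eta> then 0 else y - \<eta>\<^sup>2 / y)"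

lemma threshold_rule_soft:
  assumes "0 < \<eta>"
  shows "threshold_rule (soft_rule \<eta>) (\<lambda>m. m + \<eta>) \<eta>"
proof
  show "soft_rule \<eta> \<in> borel_measurable borel" unfolding soft_rule_def[abs_def] by measurable
  show "soft_rule \<eta> (- y) = - soft_rule \<eta> y" for y by (simp add: soft_rule_def sgn_if)
  show "0 \<le> soft_rule \<eta> y \<and> soft_rule \<eta> y \<le> y" if "0 \<le> y" for y
    using that assms by (auto simp: soft_rule_def sgn_if max_def)
  show "continuous_on UNIV (\<lambda>m. m + \<eta>)" by (intro continuous_intros)
  fix a b :: real assume ab: "0 \<le> b" "b \<le> a"
  show "\<exists>L U. (\<forall>\<theta>>b. covering_errors (soft_rule \<eta>) a b \<theta> \<subseteq> {L \<theta>..U \<theta>}) \<and>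
      (L \<longlongrightarrow> \<eta> - b) (at_right b) \<and> (U \<longlongrightarrow> (a + b) / 2 + \<eta> + (a - b) / 2) (at_right b)"
  proof (intro exI conjI allI impI)
    fix \<theta> assume "b < \<theta>"
    show "covering_errors (soft_rule \<eta>) a b \<theta> \<subseteq> {\<eta> - b..\<eta> + a}"
    proof
      fix w assume w: "w \<in> covering_errors (soft_rule \<eta>) a b \<theta>"
      then have "0 < soft_rule \<eta> (\<theta> + w)" using \<open>b < \<theta>\<close> by (simp add: covering_errors_def)
      then have "soft_rule \<eta> (\<theta> + w) = \<theta> + w - \<eta>"
        by (auto simp: soft_rule_def sgn_if max_def split: if_splits)
      then show "w \<in> {\<eta> - b..\<eta> + a}" using w by (simp add: covering_errors_def)
    qed
  next
    have eq: "(a + b) / 2 + \<eta> + (a - b) / 2 = \<eta> + a" by (simp add: field_simps)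
    show "((\<lambda>_. \<eta> + a) \<longlongrightarrow> (a + b) / 2 + \<eta> + (a - b) / 2) (at_right b)"
      unfolding eq by (rule tendsto_const)
  qed (rule tendsto_const)
next
  fix a \<theta> :: real assume a: "0 \<le> a" "a < \<theta>"
  have "soft_rule \<eta> (\<theta> + w) = \<theta> + w - \<eta>" if "\<eta> - a \<le> w" for w
    using that a assms by (auto simp: soft_rule_def sgn_if)
  then have "{\<eta> - a..a + \<eta>} \<subseteq> covering_errors (soft_rule \<eta>) a a \<theta>"
    by (auto simp: covering_errors_def)
  then show "\<exists>L U. {L..U} \<subseteq> covering_errors (soft_rule \<eta>) a a \<theta> \<and> L \<le> \<eta> - a \<and>
      U \<le> a + \<eta> \<and> a + \<eta> - (\<eta> - a) \<le> U - L \<and> 0 \<le> L + U"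
    by (intro exI[of _ "\<eta> - a"] exI[of _ "a + \<eta>"]) (use assms in auto)
qed (use assms in auto)

lemma threshold_rule_hard:
  assumes "0 < \<eta>"
  shows "threshold_rule (hard_rule \<eta>) (\<lambda>m. m) \<eta>"
proof
  show "hard_rule \<eta> \<in> borel_measurable borel" unfolding hard_rule_def[abs_def] by measurable
  show "hard_rule \<eta> (- y) = - hard_rule \<eta> y" for y by (simp add: hard_rule_def)
  show "0 \<le> hard_rule \<eta> y \<and> hard_rule \<eta> y \<le> y" if "0 \<le> y" for y
    using that by (auto simp: hard_rule_def)
  show "continuous_on UNIV (\<lambda>m::real. m)" by (intro continuous_intros)
  fix a b :: real assume ab: "0 \<le> b" "b \<le> a"
  show "\<exists>L U. (\<forall>\<theta>>b. covering_errors (hard_rule \<eta>) a b \<theta> \<subseteq> {L \<theta>..U \<theta>}) \<and>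
      (L \<longlongrightarrow> \<eta> - b) (at_right b) \<and> (U \<longlongrightarrow> (a + b) / 2 + (a - b) / 2) (at_right b)"
  proof (intro exI conjI allI impI)
    fix \<theta> assume "b < \<theta>"
    show "covering_errors (hard_rule \<eta>) a b \<theta> \<subseteq> {\<eta> - \<theta>..a}"
    proof
      fix w assume w: "w \<in> covering_errors (hard_rule \<eta>) a b \<theta>"
      then have "0 < hard_rule \<eta> (\<theta> + w)" using \<open>b < \<theta>\<close> by (simp add: covering_errors_def)
      then have "\<theta> + w > \<eta>" "hard_rule \<eta> (\<theta> + w) = \<theta> + w"
        by (auto simp: hard_rule_def split: if_splits)
      then show "w \<in> {\<eta> - \<theta>..a}" using w by (simp add: covering_errors_def)
    qed
  next
    show "((\<lambda>\<theta>. \<eta> - \<theta>) \<longlongrightarrow> \<eta> - b) (at_right b)" by (intro tendsto_intros)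
    have eq: "(a + b) / 2 + (a - b) / 2 = a" by (simp add: field_simps)
    show "((\<lambda>_. a) \<longlongrightarrow> (a + b) / 2 + (a - b) / 2) (at_right b)"
      unfolding eq by (rule tendsto_const)
  qed
next
  fix a \<theta> :: real assume a: "0 \<le> a" "a < \<theta>"
  have "hard_rule \<eta> (\<theta> + w) = \<theta> + w" if "\<eta> - a \<le> w" for w
    using that a by (auto simp: hard_rule_def)
  then have "{\<eta> - a..a} \<subseteq> covering_errors (hard_rule \<eta>) a a \<theta>"
    using assms a by (auto simp: covering_errors_def)
  then show "\<exists>L U. {L..U} \<subseteq> covering_errors (hard_rule \<eta>) a a \<theta> \<and> L \<le> \<eta> - a \<and>
      U \<le> a \<and> a - (\<eta> - a) \<le> U - L \<and> 0 \<le> L + U"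
    by (intro exI[of _ "\<eta> - a"] exI[of _ a]) (use assms in auto)
qed (use assms in auto)

text \<open>
  The positive root \<open>y\<close> of \<open>y\<^sup>2 - t * y - \<eta>\<^sup>2 = 0\<close>, that is, the inverse of the map
  \<open>y \<mapsto> y - \<eta>\<^sup>2 / y\<close> on the positive numbers.
\<close>

definition adaptive_inverse :: "real \<Rightarrow> real \<Rightarrow> real" where
  "adaptive_inverse \<eta> t = (t + sqrt (t\<^sup>2 + 4 * \<eta>\<^sup>2)) / 2"

context
  fixes \<eta> :: real
  assumes eta_pos: "0 < \<eta>"
begin

lemma abs_less_sqrt_shifted: "\<bar>t\<bar> < sqrt (t\<^sup>2 + 4 * \<eta>\<^sup>2)"
  by (rule real_less_rsqrt) (use eta_pos in simp)

lemma adaptive_inverse_pos: "0 < adaptive_inverse \<eta> t"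
  using abs_less_sqrt_shifted[of t] by (auto simp: adaptive_inverse_def abs_less_iff)

lemma adaptive_inverse_ge: "t \<le> adaptive_inverse \<eta> t"
  using abs_less_sqrt_shifted[of t] by (auto simp: adaptive_inverse_def abs_less_iff)

lemma adaptive_inverse_0: "adaptive_inverse \<eta> 0 = \<eta>"
  using eta_pos by (simp add: adaptive_inverse_def real_sqrt_mult)

lemma adaptive_inverse_double: "adaptive_inverse \<eta> (2 * m) = m + sqrt (m\<^sup>2 + \<eta>\<^sup>2)"
proof -
  have "(2 * m)\<^sup>2 + 4 * \<eta>\<^sup>2 = 4 * (m\<^sup>2 + \<eta>\<^sup>2)" by (simp add: power2_eq_square)
  then have "sqrt ((2 * m)\<^sup>2 + 4 * \<eta>\<^sup>2) = 2 * sqrt (m\<^sup>2 + \<eta>\<^sup>2)"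
    by (simp only: real_sqrt_mult real_sqrt_four)
  then show ?thesis by (simp only: adaptive_inverse_def) (simp add: add_divide_distrib)
qed

lemma adaptive_inverse_eq: "adaptive_inverse \<eta> t - \<eta>\<^sup>2 / adaptive_inverse \<eta> t = t"
proof -
  let ?q = "sqrt (t\<^sup>2 + 4 * \<eta>\<^sup>2)"
  have "?q\<^sup>2 = t\<^sup>2 + 4 * \<eta>\<^sup>2" by simp
  then have "adaptive_inverse \<eta> t * adaptive_inverse \<eta> t - \<eta>\<^sup>2 = t * adaptive_inverse \<eta> t"
    unfolding adaptive_inverse_def by (simp add: field_simps power2_eq_square)
  then show ?thesis using adaptive_inverse_pos[of t] by (simp add: field_simps)
qed

lemma shrink_less:
  fixes y y' :: real
  assumes "0 < y" "y < y'"
  shows "y - \<eta>\<^sup>2 / y < y' - \<eta>\<^sup>2 / y'"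
proof -
  have "\<eta>\<^sup>2 / y' \<le> \<eta>\<^sup>2 / y" using assms by (intro divide_left_mono) auto
  with assms show ?thesis by linarith
qed

lemma shrink_le_iff: "0 < y \<Longrightarrow> y - \<eta>\<^sup>2 / y \<le> t \<longleftrightarrow> y \<le> adaptive_inverse \<eta> t"
  using shrink_less[of y "adaptive_inverse \<eta> t"] shrink_less[of "adaptive_inverse \<eta> t" y]
    adaptive_inverse_pos[of t] adaptive_inverse_eq[of t]
  by (cases y "adaptive_inverse \<eta> t" rule: linorder_cases) auto

lemma le_shrink_iff: "0 < y \<Longrightarrow> t \<le> y - \<eta>\<^sup>2 / y \<longleftrightarrow> adaptive_inverse \<eta> t \<le> y"
  using shrink_less[of y "adaptive_inverse \<eta> t"] shrink_less[of "adaptive_inverse \<eta> t" y]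
    adaptive_inverse_pos[of t] adaptive_inverse_eq[of t]
  by (cases y "adaptive_inverse \<eta> t" rule: linorder_cases) auto

lemma DERIV_adaptive_inverse:
  "(adaptive_inverse \<eta> has_real_derivative (1 + t / sqrt (t\<^sup>2 + 4 * \<eta>\<^sup>2)) / 2) (at t)"
proof -
  have pos: "0 < t\<^sup>2 + 4 * \<eta>\<^sup>2" using eta_pos by (simp add: add_nonneg_pos)
  then have "((\<lambda>t. (t + sqrt (t\<^sup>2 + 4 * \<eta>\<^sup>2)) / 2) has_real_derivative
      (1 + t / sqrt (t\<^sup>2 + 4 * \<eta>\<^sup>2)) / 2) (at t)"
    by (auto intro!: derivative_eq_intros simp: field_simps)
  then show ?thesis unfolding adaptive_inverse_def[abs_def] .
qed

lemma slope_mono: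
  assumes "0 \<le> x" "x \<le> y"
  shows "x / sqrt (x\<^sup>2 + 4 * \<eta>\<^sup>2) \<le> y / sqrt (y\<^sup>2 + 4 * \<eta>\<^sup>2)"
proof (rule power2_le_imp_le)
  have pos: "0 < t\<^sup>2 + 4 * \<eta>\<^sup>2" for t using eta_pos by (simp add: add_nonneg_pos)
  have "x\<^sup>2 \<le> y\<^sup>2" using assms by (rule power_mono[rotated])
  then have "x\<^sup>2 * (4 * \<eta>\<^sup>2) \<le> y\<^sup>2 * (4 * \<eta>\<^sup>2)" by (rule mult_right_mono) simp
  then have "x\<^sup>2 / (x\<^sup>2 + 4 * \<eta>\<^sup>2) \<le> y\<^sup>2 / (y\<^sup>2 + 4 * \<eta>\<^sup>2)"
    using pos[of x] pos[of y]
    by (subst frac_le_eq) (auto simp: algebra_simps divide_le_0_iff)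
  then show "(x / sqrt (x\<^sup>2 + 4 * \<eta>\<^sup>2))\<^sup>2 \<le> (y / sqrt (y\<^sup>2 + 4 * \<eta>\<^sup>2))\<^sup>2"
    by (simp add: power_divide)
  show "0 \<le> y / sqrt (y\<^sup>2 + 4 * \<eta>\<^sup>2)" using assms by simp
qed

text \<open>
  The inverse is convex: its derivative is an increasing function of \<open>t / sqrt (t\<^sup>2 + 4 * \<eta>\<^sup>2)\<close>. Hence
  the covered errors form an interval whose length increases with \<open>\<theta>\<close>.
\<close>

lemma adaptive_inverse_increment_mono:
  assumes "0 \<le> c" "0 \<le> x" "x \<le> y"
  shows "adaptive_inverse \<eta> (x + c) - adaptive_inverse \<eta> x
           \<le> adaptive_inverse \<eta> (y + c) - adaptive_inverse \<eta> y"
proof (rule DERIV_nonneg_imp_nondecreasing[OF \<open>x \<le> y\<close>])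
  fix t assume t: "x \<le> t" "t \<le> y"
  let ?D = "\<lambda>t. (1 + t / sqrt (t\<^sup>2 + 4 * \<eta>\<^sup>2)) / 2"
  have "((\<lambda>t. adaptive_inverse \<eta> (t + c)) has_real_derivative ?D (t + c) * 1) (at t)"
    by (rule DERIV_chain2[OF DERIV_adaptive_inverse]) (auto intro!: derivative_eq_intros)
  then have "((\<lambda>t. adaptive_inverse \<eta> (t + c) - adaptive_inverse \<eta> t)
      has_real_derivative ?D (t + c) * 1 - ?D t) (at t)"
    by (intro DERIV_diff DERIV_adaptive_inverse)
  moreover have "?D t \<le> ?D (t + c)"
    using t assms by (intro divide_right_mono add_left_mono slope_mono) auto
  ultimately show "\<exists>D. ((\<lambda>t. adaptive_inverse \<eta> (t + c) - adaptive_inverse \<eta> t)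
      has_real_derivative D) (at t) \<and> 0 \<le> D"
    by (intro exI[of _ "?D (t + c) * 1 - ?D t"]) simp
qed

text \<open>
  The inverse has slope at most \<open>1\<close>. Hence both ends of the interval of covered errors move to the
  left as \<open>\<theta>\<close> increases.
\<close>

lemma adaptive_inverse_contracts:
  assumes "x \<le> y"
  shows "adaptive_inverse \<eta> y - y \<le> adaptive_inverse \<eta> x - x"
proof (rule DERIV_nonpos_imp_nonincreasing[OF assms])
  fix t
  let ?D = "(1 + t / sqrt (t\<^sup>2 + 4 * \<eta>\<^sup>2)) / 2"
  have "0 < sqrt (t\<^sup>2 + 4 * \<eta>\<^sup>2)" "t \<le> sqrt (t\<^sup>2 + 4 * \<eta>\<^sup>2)"
    using abs_less_sqrt_shifted[of t] by linarith+
  then have "t / sqrt (t\<^sup>2 + 4 * \<eta>\<^sup>2) \<le> 1" by (rule divide_le_eq_1_pos[THEN iffD2])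
  then have "?D \<le> (1 + 1) / 2" by (intro divide_right_mono add_left_mono) auto
  then have "?D \<le> 1" by simp
  moreover have "((\<lambda>t. adaptive_inverse \<eta> t - t) has_real_derivative ?D - 1) (at t)"
    by (intro DERIV_diff DERIV_adaptive_inverse DERIV_ident)
  ultimately show "\<exists>D. ((\<lambda>t. adaptive_inverse \<eta> t - t) has_real_derivative D) (at t) \<and> D \<le> 0"
    by (intro exI[of _ "?D - 1"]) simp
qed

text \<open>
  For \<open>\<theta> > b\<close> only positive estimates cover \<open>\<theta>\<close>, so the sample mean exceeds \<open>\<eta>\<close> and the rule can be
  inverted.
\<close>

lemma covering_errors_adaptive:
  assumes "0 \<le> b" "b < \<theta>"
  shows "covering_errors (adaptive_rule \<eta>) a b \<theta>
           = {adaptive_inverse \<eta> (\<theta> - b) - \<theta>..adaptive_inverse \<eta> (\<theta> + a) - \<theta>}"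
proof (intro equalityI subsetI)
  fix w assume w: "w \<in> covering_errors (adaptive_rule \<eta>) a b \<theta>"
  then have pos: "0 < adaptive_rule \<eta> (\<theta> + w)" using assms by (simp add: covering_errors_def)
  have "\<eta> < \<theta> + w"
  proof (rule ccontr)
    assume "\<not> \<eta> < \<theta> + w"
    with pos have y: "\<theta> + w < - \<eta>" "adaptive_rule \<eta> (\<theta> + w) = \<theta> + w - \<eta>\<^sup>2 / (\<theta> + w)"
      by (auto simp: adaptive_rule_def split: if_splits)
    have "\<eta> - \<eta>\<^sup>2 / \<eta> < - (\<theta> + w) - \<eta>\<^sup>2 / - (\<theta> + w)"
      using eta_pos y by (intro shrink_less) auto
    moreover have "\<eta> - \<eta>\<^sup>2 / \<eta> = 0" using eta_pos by (simp add: power2_eq_square)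
    ultimately have "0 < - (\<theta> + w) - - (\<eta>\<^sup>2 / (\<theta> + w))"
      by (simp only: divide_minus_right)
    moreover have "0 < \<theta> + w - \<eta>\<^sup>2 / (\<theta> + w)" using pos by (simp only: y(2))
    ultimately show False by (simp only: diff_minus_eq_add)
  qed
  then have "adaptive_rule \<eta> (\<theta> + w) = \<theta> + w - \<eta>\<^sup>2 / (\<theta> + w)" "0 < \<theta> + w"
    using eta_pos by (auto simp: adaptive_rule_def)
  with w have "\<theta> - b \<le> \<theta> + w - \<eta>\<^sup>2 / (\<theta> + w)" "\<theta> + w - \<eta>\<^sup>2 / (\<theta> + w) \<le> \<theta> + a" "0 < \<theta> + w"
    by (auto simp: covering_errors_def)
  then show "w \<in> {adaptive_inverse \<eta> (\<theta> - b) - \<theta>..adaptive_inverse \<eta> (\<theta> + a) - \<theta>}"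
    by (simp add: shrink_le_iff le_shrink_iff)
next
  fix w assume w: "w \<in> {adaptive_inverse \<eta> (\<theta> - b) - \<theta>..adaptive_inverse \<eta> (\<theta> + a) - \<theta>}"
  then have y: "adaptive_inverse \<eta> (\<theta> - b) \<le> \<theta> + w" "0 < \<theta> + w"
    using adaptive_inverse_pos[of "\<theta> - b"] by auto
  then have le: "\<theta> - b \<le> \<theta> + w - \<eta>\<^sup>2 / (\<theta> + w)" "\<theta> + w - \<eta>\<^sup>2 / (\<theta> + w) \<le> \<theta> + a"
    using w by (auto simp: shrink_le_iff le_shrink_iff)
  have "\<eta> < \<theta> + w"
  proof (rule ccontr)
    assume "\<not> \<eta> < \<theta> + w"
    then have "\<theta> + w - \<eta>\<^sup>2 / (\<theta> + w) \<le> \<eta> - \<eta>\<^sup>2 / \<eta>"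
      using shrink_less[of "\<theta> + w" \<eta>] y by (cases "\<theta> + w = \<eta>") auto
    also have "\<dots> = 0" using eta_pos by (simp add: power2_eq_square)
    finally show False using le assms by linarith
  qed
  then show "w \<in> covering_errors (adaptive_rule \<eta>) a b \<theta>"
    using le eta_pos by (simp add: covering_errors_def adaptive_rule_def)
qed

lemma threshold_rule_adaptive: "threshold_rule (adaptive_rule \<eta>) (\<lambda>m. sqrt (m\<^sup>2 + \<eta>\<^sup>2)) \<eta>"
proof
  show "0 < \<eta>" by (rule eta_pos)
  show "adaptive_rule \<eta> \<in> borel_measurable borel"
    unfolding adaptive_rule_def[abs_def] by measurable
  show "adaptive_rule \<eta> (- y) = - adaptive_rule \<eta> y" for y by (simp add: adaptive_rule_def)
  show "0 \<le> adaptive_rule \<eta> y \<and> adaptive_rule \<eta> y \<le> y" if "0 \<le> y" for y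
  proof (cases "y \<le> \<eta>")
    case False
    then have "\<eta> - \<eta>\<^sup>2 / \<eta> < y - \<eta>\<^sup>2 / y" using eta_pos by (intro shrink_less) auto
    then show ?thesis using False eta_pos by (simp add: adaptive_rule_def power2_eq_square)
  qed (use that in \<open>simp add: adaptive_rule_def\<close>)
  show "m \<le> sqrt (m\<^sup>2 + \<eta>\<^sup>2) \<and> sqrt (m\<^sup>2 + \<eta>\<^sup>2) \<le> m + \<eta>" if "0 \<le> m" for m
    using that eta_pos sqrt_add_le_add_sqrt[of "m\<^sup>2" "\<eta>\<^sup>2"] by (auto intro: real_le_rsqrt)
  show "sqrt (m\<^sup>2 + \<eta>\<^sup>2) \<le> sqrt (m'\<^sup>2 + \<eta>\<^sup>2)" if "0 \<le> m" "m \<le> m'" for m m'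
    using that by (simp add: power_mono)
  show "continuous_on UNIV (\<lambda>m. sqrt (m\<^sup>2 + \<eta>\<^sup>2))" by (intro continuous_intros)
  fix a b :: real assume ab: "0 \<le> b" "b \<le> a"
  show "\<exists>L U. (\<forall>\<theta>>b. covering_errors (adaptive_rule \<eta>) a b \<theta> \<subseteq> {L \<theta>..U \<theta>}) \<and>
      (L \<longlongrightarrow> \<eta> - b) (at_right b) \<and>
      (U \<longlongrightarrow> sqrt (((a + b) / 2)\<^sup>2 + \<eta>\<^sup>2) + (a - b) / 2) (at_right b)"
  proof (intro exI conjI allI impI)
    show "covering_errors (adaptive_rule \<eta>) a b \<theta>
        \<subseteq> {adaptive_inverse \<eta> (\<theta> - b) - \<theta>..adaptive_inverse \<eta> (\<theta> + a) - \<theta>}" if "b < \<theta>" for \<theta>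
      using covering_errors_adaptive[of b \<theta> a] ab that by simp
    have cont: "isCont (adaptive_inverse \<eta>) t" for t
      using DERIV_adaptive_inverse by (rule DERIV_isCont)
    have "((\<lambda>\<theta>. adaptive_inverse \<eta> (\<theta> - b) - \<theta>) \<longlongrightarrow> adaptive_inverse \<eta> (b - b) - b) (at_right b)"
      by (intro tendsto_diff isCont_tendsto_compose[OF cont] tendsto_ident_at tendsto_const)
    then show "((\<lambda>\<theta>. adaptive_inverse \<eta> (\<theta> - b) - \<theta>) \<longlongrightarrow> \<eta> - b) (at_right b)"
      by (simp add: adaptive_inverse_0)
    have "((\<lambda>\<theta>. adaptive_inverse \<eta> (\<theta> + a) - \<theta>) \<longlongrightarrow> adaptive_inverse \<eta> (b + a) - b) (at_right b)"
      by (intro tendsto_diff tendsto_add isCont_tendsto_compose[OF cont] tendsto_ident_at tendsto_const)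
    moreover have "adaptive_inverse \<eta> (b + a) - b = sqrt (((a + b) / 2)\<^sup>2 + \<eta>\<^sup>2) + (a - b) / 2"
    proof -
      have solve: "x - b = q + (a - b) / 2" if "x = (a + b) / 2 + q" for x q :: real
        using that by (simp add: field_simps)
      have double: "2 * ((a + b) / 2) = b + a" by simp
      show ?thesis
        by (rule solve) (rule adaptive_inverse_double[of "(a + b) / 2", unfolded double])
    qed
    ultimately show "((\<lambda>\<theta>. adaptive_inverse \<eta> (\<theta> + a) - \<theta>)
        \<longlongrightarrow> sqrt (((a + b) / 2)\<^sup>2 + \<eta>\<^sup>2) + (a - b) / 2) (at_right b)"
      by simp
  qed
next
  fix a \<theta> :: real assume a: "0 \<le> a" "a < \<theta>"
  show "\<exists>L U. {L..U} \<subseteq> covering_errors (adaptive_rule \<eta>) a a \<theta> \<and> L \<le> \<eta> - a \<and>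
      U \<le> sqrt (a\<^sup>2 + \<eta>\<^sup>2) \<and> sqrt (a\<^sup>2 + \<eta>\<^sup>2) - (\<eta> - a) \<le> U - L \<and> 0 \<le> L + U"
  proof (intro exI conjI)
    let ?L = "adaptive_inverse \<eta> (\<theta> - a) - \<theta>" and ?U = "adaptive_inverse \<eta> (\<theta> + a) - \<theta>"
    show "{?L..?U} \<subseteq> covering_errors (adaptive_rule \<eta>) a a \<theta>"
      unfolding covering_errors_adaptive[OF a] by (rule order_refl)
    show "?L \<le> \<eta> - a"
      using adaptive_inverse_contracts[of 0 "\<theta> - a"] a by (simp add: adaptive_inverse_0)
    show "?U \<le> sqrt (a\<^sup>2 + \<eta>\<^sup>2)"
      using adaptive_inverse_contracts[of "2 * a" "\<theta> + a"] a by (simp add: adaptive_inverse_double)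
    show "sqrt (a\<^sup>2 + \<eta>\<^sup>2) - (\<eta> - a) \<le> ?U - ?L"
    proof -
      have ends: "0 + 2 * a = 2 * a" "\<theta> - a + 2 * a = \<theta> + a" by simp_all
      have "adaptive_inverse \<eta> (2 * a) - adaptive_inverse \<eta> 0
          \<le> adaptive_inverse \<eta> (\<theta> + a) - adaptive_inverse \<eta> (\<theta> - a)"
        using adaptive_inverse_increment_mono[of "2 * a" 0 "\<theta> - a", unfolded ends] a by simp
      then show ?thesis unfolding adaptive_inverse_double adaptive_inverse_0 by linarith
    qed
    show "0 \<le> ?L + ?U"
      using adaptive_inverse_ge[of "\<theta> - a"] adaptive_inverse_ge[of "\<theta> + a"] by linarith
  qed
qed

end


section \<open>The error of the sample mean\<close>

abbreviation centred_normal :: "real \<Rightarrow> real measure" where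
  "centred_normal \<sigma> \<equiv> density lborel (normal_density 0 \<sigma>)"

lemma real_distribution_centred_normal: "0 < \<sigma> \<Longrightarrow> real_distribution (centred_normal \<sigma>)"
  by (intro real_distribution.intro real_distribution_axioms.intro prob_space_normal_density) auto

lemma measure_centred_normal_Icc:
  assumes "0 < \<sigma>"
  shows "measure (centred_normal \<sigma>) {a..b} = integral {a..b} (normal_density 0 \<sigma>)"
proof -
  have "measure (centred_normal \<sigma>) {a..b}
      = integral\<^sup>L (centred_normal \<sigma>) (indicator {a..b})" by simp
  also have "\<dots> = (LINT x:{a..b}|lborel. normal_density 0 \<sigma> x)"
    unfolding set_lebesgue_integral_def
    by (subst integral_density) (auto simp: mult.commute)
  also have "\<dots> = integral {a..b} (normal_density 0 \<sigma>)"
  proof (rule set_borel_integral_eq_integral)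
    show "set_integrable lborel {a..b} (normal_density 0 \<sigma>)"
      unfolding set_integrable_def
      by (intro integrable_mult_indicator integrable_normal_density assms) simp
  qed
  finally show ?thesis .
qed

text \<open>
  The fundamental theorem of calculus on \<open>[x - 1, x + 1]\<close>; any left end point below \<open>x\<close> would do.
\<close>

lemma DERIV_cdf_centred_normal:
  assumes "0 < \<sigma>"
  shows "(cdf (centred_normal \<sigma>) has_real_derivative normal_density 0 \<sigma> x) (at x)"
proof -
  let ?M = "centred_normal \<sigma>"
  interpret real_distribution ?M using assms by (rule real_distribution_centred_normal)
  let ?f = "normal_density 0 \<sigma>" and ?a = "x - 1"
  have cdf: "cdf ?M ?a + integral {?a..y} ?f = cdf ?M y" if "?a < y" for y
  proof -
    have "{?a..y} = {?a} \<union> {?a<..y}" using that by auto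
    then have "measure ?M {?a..y} = measure ?M {?a} + measure ?M {?a<..y}"
      by (simp only:) (rule finite_measure_Union; auto)
    moreover have "measure ?M {?a} = 0"
      using measure_centred_normal_Icc[OF assms, of ?a ?a] by simp
    ultimately show ?thesis
      using cdf_diff_eq[OF that] measure_centred_normal_Icc[OF assms, of ?a y] by simp
  qed
  have "continuous_on {?a..x + 1} ?f"
    unfolding normal_density_def[abs_def] using assms by (intro continuous_intros) auto
  then have "((\<lambda>y. integral {?a..y} ?f) has_real_derivative ?f x) (at x within {?a..x + 1})"
    by (rule integral_has_real_derivative) auto
  then have "((\<lambda>y. integral {?a..y} ?f) has_real_derivative ?f x) (at x)"
    by (simp add: at_within_Icc_at)
  then have "((\<lambda>y. cdf ?M ?a + integral {?a..y} ?f) has_real_derivative 0 + ?f x) (at x)"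
    by (intro DERIV_add DERIV_const)
  then have "(cdf ?M has_real_derivative 0 + ?f x) (at x)"
    by (rule has_field_derivative_transform_within_open[where S = "{?a<..}"]) (auto simp: cdf)
  then show ?thesis by simp
qed

lemma symmetric_unimodal_centred_normal:
  assumes "0 < \<sigma>"
  shows "symmetric_unimodal (centred_normal \<sigma>) (normal_density 0 \<sigma>)"
proof (intro symmetric_unimodal.intro real_distribution_centred_normal
    symmetric_unimodal_axioms.intro DERIV_cdf_centred_normal normal_density_pos assms)
  show "normal_density 0 \<sigma> (- x) = normal_density 0 \<sigma> x" for x
    by (simp add: normal_density_def)
  fix x y :: real assume "\<bar>x\<bar> < \<bar>y\<bar>"
  then have "x\<^sup>2 < y\<^sup>2" by (metis abs_le_square_iff not_le)
  then have "- y\<^sup>2 / (2 * \<sigma>\<^sup>2) < - x\<^sup>2 / (2 * \<sigma>\<^sup>2)"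
    using assms by (intro divide_strict_right_mono) auto
  moreover have "0 < sqrt (2 * pi * \<sigma>\<^sup>2)" using assms by simp
  ultimately show "normal_density 0 \<sigma> y < normal_density 0 \<sigma> x"
    unfolding normal_density_def by (intro mult_strict_left_mono) auto
qed

lemma cdf_centred_normal:
  assumes "0 < \<sigma>"
  shows "cdf (centred_normal \<sigma>) x = std_normal_cdf (x / \<sigma>)"
proof -
  interpret prob_space std_normal_distribution
    using prob_space_normal_density[of 1 0] by simp
  have "distributed std_normal_distribution lborel (\<lambda>x. x) std_normal_density"
    by (auto simp: distributed_def distr_id2 intro!: measure_eqI)
  from normal_density_affine[OF this, of \<sigma> 0]
  have "distributed std_normal_distribution lborel (\<lambda>x. \<sigma> * x) (normal_density 0 \<sigma>)"
    using assms by simp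
  then have "centred_normal \<sigma> = distr std_normal_distribution lborel (\<lambda>x. \<sigma> * x)"
    by (simp add: distributed_def)
  then have "cdf (centred_normal \<sigma>) x = measure (distr std_normal_distribution lborel (\<lambda>x. \<sigma> * x)) {..x}"
    by (simp add: cdf_def)
  also have "\<dots> = measure std_normal_distribution ((\<lambda>x. \<sigma> * x) -` {..x})"
    by (subst measure_distr) auto
  also have "(\<lambda>x. \<sigma> * x) -` {..x} = {..x / \<sigma>}" using assms by (auto simp: field_simps)
  finally show ?thesis by (simp add: std_normal_cdf_def cdf_def)
qed

abbreviation mean_error :: "nat \<Rightarrow> real measure" where
  "mean_error n \<equiv> centred_normal (1 / sqrt (real n))"

text \<open>
  The coordinates of a product measure are independent, and a sum of independent normal variables is
  normal; centring and dividing by \<open>n\<close> leaves variance \<open>1 / n\<close>.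
\<close>

lemma measure_sample_mean_error:
  assumes "n \<ge> 1" "B \<in> sets borel"
  shows "measure (sample_dist n \<theta>) {y \<in> space (sample_dist n \<theta>). sample_mean n y - \<theta> \<in> B}
           = measure (mean_error n) B"
proof -
  let ?N = "\<lambda>i::nat. density lborel (normal_density \<theta> 1)"
  let ?P = "sample_dist n \<theta>"
  have N: "prob_space (?N i)" for i by (rule prob_space_normal_density) simp
  have P: "?P = PiM {1..n} ?N" by (simp add: sample_dist_def)
  interpret prob_space ?P unfolding P by (rule prob_space_PiM[OF N])
  have coord: "(\<lambda>y. y i) \<in> measurable ?P borel" if "i \<in> {1..n}" for i
    using measurable_component_singleton[OF that, of ?N] unfolding P
    by (simp add: measurable_def)
  have distr_coord: "distr ?P borel (\<lambda>y. y i) = ?N i" if "i \<in> {1..n}" for i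
  proof -
    have "distr ?P borel (\<lambda>y. y i) = distr ?P (?N i) (\<lambda>y. y i)"
      by (rule distr_cong) auto
    then show ?thesis using distr_PiM_component[OF N that] by (simp add: P)
  qed
  have indep: "indep_vars (\<lambda>_. borel) (\<lambda>i y. y i) {1..n}"
  proof (subst indep_vars_iff_distr_eq_PiM')
    have "distr ?P (Pi\<^sub>M {1..n} (\<lambda>i. borel)) (\<lambda>y. \<lambda>i\<in>{1..n}. y i) = distr ?P ?P (\<lambda>y. y)"
    proof (rule distr_cong)
      show "sets (Pi\<^sub>M {1..n} (\<lambda>i. borel)) = sets ?P"
        unfolding P by (rule sets_PiM_cong) auto
      show "(\<lambda>i\<in>{1..n}. y i) = y" if "y \<in> space ?P" for y
        using that by (auto simp: P space_PiM PiE_restrict)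
    qed simp
    also have "\<dots> = ?P" by (rule distr_id)
    also have "\<dots> = Pi\<^sub>M {1..n} (\<lambda>i. distr ?P borel (\<lambda>y. y i))"
    proof (subst P, rule PiM_cong)
      show "?N i = distr ?P borel (\<lambda>y. y i)" if "i \<in> {1..n}" for i
        using distr_coord[OF that] by (rule sym)
    qed (rule refl)
    finally show "distr ?P (Pi\<^sub>M {1..n} (\<lambda>i. borel)) (\<lambda>y. \<lambda>i\<in>{1..n}. y i)
        = Pi\<^sub>M {1..n} (\<lambda>i. distr ?P borel (\<lambda>y. y i))" .
  qed (use assms coord in auto)
  have "distributed ?P lborel (\<lambda>y. \<Sum>i\<in>{1..n}. y i)
      (normal_density (\<Sum>i\<in>{1..n}. \<theta>) (sqrt (\<Sum>i\<in>{1..n}. 1\<^sup>2)))"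
  proof (rule sum_indep_normal[OF _ _ indep])
    show "distributed ?P lborel (\<lambda>y. y i) (normal_density \<theta> 1)" if "i \<in> {1..n}" for i
      unfolding distributed_def
      using coord[OF that] distr_coord[OF that] by (auto cong: distr_cong)
  qed (use assms in auto)
  then have "distributed ?P lborel (\<lambda>y. - \<theta> + 1 / real n * (\<Sum>i\<in>{1..n}. y i))
      (normal_density (- \<theta> + 1 / real n * (\<Sum>i\<in>{1..n}. \<theta>))
        (\<bar>1 / real n\<bar> * sqrt (\<Sum>i\<in>{1..n}. 1\<^sup>2)))"
    by (rule normal_density_affine) (use assms in auto)
  moreover have "- \<theta> + 1 / real n * (\<Sum>i\<in>{1..n}. \<theta>) = 0" using assms by simp
  moreover have "\<bar>1 / real n\<bar> * sqrt (\<Sum>i\<in>{1..n}. 1\<^sup>2) = 1 / sqrt (real n)"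
    using assms by (simp add: real_div_sqrt field_simps)
  moreover have "(\<lambda>y. - \<theta> + 1 / real n * (\<Sum>i\<in>{1..n}. y i)) = (\<lambda>y. sample_mean n y - \<theta>)"
    by (auto simp: sample_mean_def)
  ultimately have D: "distributed ?P lborel (\<lambda>y. sample_mean n y - \<theta>)
      (normal_density 0 (1 / sqrt (real n)))" by simp
  have "measure (mean_error n) B = measure (distr ?P lborel (\<lambda>y. sample_mean n y - \<theta>)) B"
    using D by (simp add: distributed_def)
  also have "\<dots> = measure ?P ((\<lambda>y. sample_mean n y - \<theta>) -` B \<inter> space ?P)"
    using D assms by (intro measure_distr) (auto simp: distributed_def)
  also have "(\<lambda>y. sample_mean n y - \<theta>) -` B \<inter> space ?P
      = {y \<in> space ?P. sample_mean n y - \<theta> \<in> B}" by auto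
  finally show ?thesis by simp
qed

lemma coverage_eq_measure_errors:
  assumes "n \<ge> 1" "covering_errors T a b \<theta> \<in> sets borel"
  shows "coverage n (\<lambda>y. T (sample_mean n y)) a b \<theta>
           = measure (mean_error n) (covering_errors T a b \<theta>)"
proof -
  have "coverage n (\<lambda>y. T (sample_mean n y)) a b \<theta>
      = measure (sample_dist n \<theta>)
          {y \<in> space (sample_dist n \<theta>). sample_mean n y - \<theta> \<in> covering_errors T a b \<theta>}"
    by (simp add: coverage_def covering_errors_def)
  then show ?thesis using measure_sample_mean_error[OF assms] by simp
qed

section \<open>Half-lengths and their order\<close>

lemma shortest_half_length_eqI:
  assumes "0 \<le> h" "infimal_coverage n est h h = \<delta>"
    and min: "\<And>a b. 0 \<le> a \<Longrightarrow> 0 \<le> b \<Longrightarrow> \<delta> \<le> infimal_coverage n est a b \<Longrightarrow> h \<le> (a + b) / 2"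
  shows "shortest_half_length n est \<delta> = h"
  unfolding shortest_half_length_def
proof (rule the_equality)
  have "h + h \<le> a + b" if "0 \<le> a" "0 \<le> b" "\<delta> \<le> infimal_coverage n est a b" for a b
    using min[OF that] by simp
  then have "shortest_interval n est \<delta> h h" using assms by (simp add: shortest_interval_def)
  then show "\<exists>a b. shortest_interval n est \<delta> a b \<and> h = (a + b) / 2"
    by (intro exI[of _ h]) simp
  fix h' assume "\<exists>a b. shortest_interval n est \<delta> a b \<and> h' = (a + b) / 2"
  then obtain a b where ab: "shortest_interval n est \<delta> a b" "h' = (a + b) / 2" by blast
  then have "h \<le> (a + b) / 2" using min[of a b] by (auto simp: shortest_interval_def)
  moreover have "a + b \<le> h + h"
    using ab(1) assms(1,2) unfolding shortest_interval_def by (metis order_refl)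
  ultimately show "h' = h" using ab(2) by simp
qed

lemma shortest_half_length_threshold:
  assumes "n \<ge> 1" "threshold_rule T u \<eta>" "0 < \<delta>" "\<delta> < 1"
  defines "h \<equiv> shortest_half_length n (\<lambda>y. T (sample_mean n y)) \<delta>"
  shows "0 < h"
    and "cdf (mean_error n) (u h) - cdf (mean_error n) (\<eta> - h) = \<delta>"
proof -
  interpret threshold_problem "mean_error n" "normal_density 0 (1 / sqrt (real n))" T u \<eta>
    by (intro threshold_problem.intro symmetric_unimodal_centred_normal assms) (use assms in simp)
  have inf: "infimal_coverage n (\<lambda>y. T (sample_mean n y)) a b = (INF \<theta>. cover a b \<theta>)" for a b
    unfolding infimal_coverage_def cover_def
    using coverage_eq_measure_errors[OF assms(1) covering_errors_measurable] by simp
  obtain k where k: "0 < k" "jump_coverage k = \<delta>" using jump_coverage_attains assms by blast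
  have "h = k"
    unfolding h_def
  proof (rule shortest_half_length_eqI)
    show "infimal_coverage n (\<lambda>y. T (sample_mean n y)) k k = \<delta>"
      unfolding inf using k assms by (intro INF_cover_eq)
    fix a b :: real assume ab: "0 \<le> a" "0 \<le> b" "\<delta> \<le> infimal_coverage n (\<lambda>y. T (sample_mean n y)) a b"
    then have "jump_coverage k \<le> jump_coverage ((a + b) / 2)"
      using INF_cover_le_jump_coverage k assms unfolding inf by simp
    then show "k \<le> (a + b) / 2" using jump_coverage_less_iff[of "(a + b) / 2" k] k ab by simp
  qed (use k in simp)
  with k show "0 < h" "cdf (mean_error n) (u h) - cdf (mean_error n) (\<eta> - h) = \<delta>"
    by (simp_all add: jump_coverage_def)
qed

text \<open>
  At the root \<open>h\<close> belonging to \<open>u\<close>, the function of the rule with the larger \<open>u'\<close> already exceeds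
  \<open>\<delta>\<close>, so its own root is smaller.
\<close>

lemma shortest_half_length_less:
  assumes "n \<ge> 1" "threshold_rule T u \<eta>" "threshold_rule T' u' \<eta>" "0 < \<delta>" "\<delta> < 1"
    and less: "\<And>m. 0 < m \<Longrightarrow> u m < u' m"
  shows "shortest_half_length n (\<lambda>y. T' (sample_mean n y)) \<delta>
           < shortest_half_length n (\<lambda>y. T (sample_mean n y)) \<delta>"
proof -
  interpret threshold_problem "mean_error n" "normal_density 0 (1 / sqrt (real n))" T' u' \<eta>
    by (intro threshold_problem.intro symmetric_unimodal_centred_normal assms) (use assms in simp)
  define h h' where "h = shortest_half_length n (\<lambda>y. T (sample_mean n y)) \<delta>"
    and "h' = shortest_half_length n (\<lambda>y. T' (sample_mean n y)) \<delta>"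
  have h: "0 < h" "G (u h) - G (\<eta> - h) = \<delta>"
    unfolding h_def using shortest_half_length_threshold[OF assms(1,2,4,5)] by auto
  have h': "0 < h'" "jump_coverage h' = \<delta>"
    unfolding h'_def jump_coverage_def using shortest_half_length_threshold[OF assms(1,3,4,5)] by auto
  have "jump_coverage h' < jump_coverage h"
    using h h' less[OF h(1)] G_less_iff[of "u h" "u' h"] by (simp add: jump_coverage_def)
  then show ?thesis using h h' jump_coverage_less_iff[of h' h] by (simp add: h_def h'_def)
qed

text \<open>
  The quantile is defined as an inverse function on all of the reals; the intermediate value theorem
  shows that \<open>(1 + \<delta>) / 2\<close> is in the range, so that it is a quantile there. As this level exceeds
  \<open>G 0 = 1 / 2\<close>, it is positive.
\<close>

lemma cdf_standard_half_length:
  assumes "n \<ge> 1" "0 < \<delta>" "\<delta> < 1"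
  shows "0 < standard_half_length n \<delta>"
    and "cdf (mean_error n) (standard_half_length n \<delta>) = (1 + \<delta>) / 2"
proof -
  let ?q = "std_normal_quantile ((1 + \<delta>) / 2)"
  interpret symmetric_unimodal std_normal_distribution std_normal_density
    by (rule symmetric_unimodal_centred_normal) simp
  have half: "G 0 = 1 / 2" using G_minus[of 0] by simp
  obtain m where "0 \<le> m" "(1 + \<delta>) / 2 < G m"
  proof -
    have "\<forall>\<^sub>F m in at_top. (1 + \<delta>) / 2 < G m"
      using assms by (intro order_tendstoD[OF cdf_lim_at_top_prob]) auto
    then have "\<forall>\<^sub>F m in at_top. 0 \<le> m \<and> (1 + \<delta>) / 2 < G m"
      by (intro eventually_conj eventually_ge_at_top)
    then show ?thesis using that eventually_happens' trivial_limit_at_top_linorder by blast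
  qed
  then obtain x where "G x = (1 + \<delta>) / 2"
    using IVT'[of G 0 "(1 + \<delta>) / 2" m] half assms continuous_on_G by auto
  then have range: "(1 + \<delta>) / 2 \<in> range G" by (metis rangeI)
  have q: "G ?q = (1 + \<delta>) / 2"
    unfolding std_normal_quantile_def std_normal_cdf_def using range by (rule f_inv_into_f)
  then have "G 0 < G ?q" using half assms by simp
  then have "0 < ?q" by (simp add: G_less_iff)
  have std: "standard_half_length n \<delta> = ?q / sqrt (real n)"
    unfolding standard_half_length_def
    using powr_minus[of "real n" "1 / 2"] by (simp add: powr_half_sqrt inverse_eq_divide)
  show "0 < standard_half_length n \<delta>" using \<open>0 < ?q\<close> assms by (simp add: std)
  show "cdf (mean_error n) (standard_half_length n \<delta>) = (1 + \<delta>) / 2"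
  proof -
    have \<sigma>: "0 < 1 / sqrt (real n)" and scale: "?q / sqrt (real n) / (1 / sqrt (real n)) = ?q"
      using assms(1) by simp_all
    show ?thesis
      unfolding std cdf_centred_normal[OF \<sigma>] scale std_normal_cdf_def by (rule q)
  qed
qed

lemma coverage_sample_mean_standard:
  assumes "n \<ge> 1" "0 < \<delta>" "\<delta> < 1"
  shows "coverage n (sample_mean n) (standard_half_length n \<delta>) (standard_half_length n \<delta>) \<theta> = \<delta>"
proof -
  let ?h = "standard_half_length n \<delta>"
  interpret symmetric_unimodal "mean_error n" "normal_density 0 (1 / sqrt (real n))"
    by (rule symmetric_unimodal_centred_normal) (use assms in simp)
  have set: "covering_errors (\<lambda>y. y) ?h ?h \<theta> = {- ?h..?h}" by (auto simp: covering_errors_def)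
  have "coverage n (sample_mean n) ?h ?h \<theta> = max 0 (G ?h - G (- ?h))"
    using coverage_eq_measure_errors[of n "\<lambda>y. y" ?h ?h \<theta>] assms
    by (simp add: set measure_Icc)
  also have "\<dots> = \<delta>"
    using cdf_standard_half_length[OF assms] assms by (simp add: symmetric_mass)
  finally show ?thesis .
qed

lemma standard_half_length_less_threshold:
  assumes "n \<ge> 1" "threshold_rule T u \<eta>" "0 < \<delta>" "\<delta> < 1"
  shows "standard_half_length n \<delta> < shortest_half_length n (\<lambda>y. T (sample_mean n y)) \<delta>"
proof -
  interpret threshold_problem "mean_error n" "normal_density 0 (1 / sqrt (real n))" T u \<eta>
    by (intro threshold_problem.intro symmetric_unimodal_centred_normal assms) (use assms in simp)
  define h where "h = shortest_half_length n (\<lambda>y. T (sample_mean n y)) \<delta>"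
  have h: "0 < h" "jump_coverage h = \<delta>"
    unfolding h_def jump_coverage_def using shortest_half_length_threshold[OF assms] by auto
  have "G (standard_half_length n \<delta>) < G h"
    using jump_coverage_less_symmetric_mass[OF h(1)] h(2) cdf_standard_half_length(2)[OF assms(1,3,4)]
    by (simp add: symmetric_mass)
  then show ?thesis by (simp add: G_less_iff h_def)
qed

theorem mainTheorem4:
  fixes n :: nat and \<eta> \<delta> :: real
  assumes "n \<ge> 1" and "\<eta> > 0" and "0 < \<delta>" and "\<delta> < 1"
  shows "shortest_half_length n (hard_thresholding n \<eta>) \<delta>
           > shortest_half_length n (adaptive_lasso n \<eta>) \<delta>
       \<and> shortest_half_length n (adaptive_lasso n \<eta>) \<delta>
           > shortest_half_length n (soft_thresholding n \<eta>) \<delta>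
       \<and> shortest_half_length n (soft_thresholding n \<eta>) \<delta> > standard_half_length n \<delta>
       \<and> (\<forall>\<theta>. coverage n (sample_mean n) (standard_half_length n \<delta>) (standard_half_length n \<delta>) \<theta> = \<delta>)"
proof -
  note soft = threshold_rule_soft[OF assms(2)]
    and hard = threshold_rule_hard[OF assms(2)]
    and adaptive = threshold_rule_adaptive[OF assms(2)]
  have est: "hard_thresholding n \<eta> = (\<lambda>y. hard_rule \<eta> (sample_mean n y))"
    "adaptive_lasso n \<eta> = (\<lambda>y. adaptive_rule \<eta> (sample_mean n y))"
    "soft_thresholding n \<eta> = (\<lambda>y. soft_rule \<eta> (sample_mean n y))"
    by (auto simp: hard_thresholding_def adaptive_lasso_def soft_thresholding_def
        hard_rule_def adaptive_rule_def soft_rule_def)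
  have "m < sqrt (m\<^sup>2 + \<eta>\<^sup>2)" for m
    using assms by (intro real_less_rsqrt) auto
  note hard_adaptive = shortest_half_length_less[OF assms(1) hard adaptive assms(3,4) this]
  have "sqrt (m\<^sup>2 + \<eta>\<^sup>2) < m + \<eta>" if "0 < m" for m
    using assms that by (intro real_less_lsqrt) (auto simp: power2_sum)
  note adaptive_soft = shortest_half_length_less[OF assms(1) adaptive soft assms(3,4) this]
  show ?thesis
    unfolding est
    using hard_adaptive adaptive_soft standard_half_length_less_threshold[OF assms(1) soft assms(3,4)]
      coverage_sample_mean_standard[OF assms(1,3,4)]
    by blast
qed

end
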